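(* Let $\mathcal{H}$ be a finite set of hypotheses with a prior $P$ taking rational values, $\mathcal{T}$ a finite set of tests, $\mathcal{O}$ a finite set of outcomes, each $h\in\mathcal{H}$ a function $h:\mathcal{T}\to\mathcal{O}$, and $\mathcal{R}$ a finite collection of decision regions covering $\mathcal{H}$. Let $k$, $f_{\mathrm{HEC}}$, $\Delta$ be as in the context, let $\pi_{\mathrm{HEC}}$ be the greedy HEC policy and $\pi^*$ an optimal feasible policy. Then $$\mathcal{C}(\pi_{\mathrm{HEC}})\le \big(k\ln(1/p_{\min})+1\big)\,\mathcal{C}(\pi^* ),\qquad p_{\min}=\min_{h\in\mathcal{H}}P(h).$$
   Context: Subregions: hypotheses are grouped into the same subregion iff they belong to exactly the same decision regions; $\mathcal{G}$ is the set of these classes and $g\subseteq r$ means all hypotheses of $g$ lie in $r$. $k=\min\big(\max_{h}|\{r: h\in r\}|,\ \max_{r}|\{g\in\mathcal{G}: g\subseteq r\}|\big)+1$. $\mathcal{E}$ is the set of multisets of exactly $k$ subregions (repetitions allowed) not all contained in a single region. For evidence $\mathcal{S}\subseteq\mathcal{T}\times\mathcal{O}$, $\mathcal{V}(\mathcal{S})=\{h: h(t)=o\ \forall(t,o)\in\mathcal{S}\}$, $f_{\mathrm{HEC}}(\mathcal{S})=\sum_{e\in\mathcal{E}}\prod_{g\in e}P(g)-\sum_{e\in\mathcal{E}}\prod_{g\in e}P(g\cap\mathcal{V}(\mathcal{S}))$ (products counting multiplicity, $P(A)=\sum_{h\in A}P(h)$), and $\Delta(t\mid\mathcal{S})=\sum_{h\in\mathcal{V}(\mathcal{S})}\frac{P(h)}{P(\mathcal{V}(\mathcal{S}))}\big(f_{\mathrm{HEC}}(\mathcal{S}\cup\{(t,h(t))\})-f_{\mathrm{HEC}}(\mathcal{S})\big)$.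 A policy maps the evidence gathered so far to a next test or to stopping; when the true hypothesis is $h$, running it produces the set of tests $\mathcal{T}(\pi,h)$ and evidence $\{(t,h(t)):t\in\mathcal{T}(\pi,h)\}$. Its cost is $\mathcal{C}(\pi)=\sum_{h}P(h)|\mathcal{T}(\pi,h)|$. A policy is feasible if for every $h$ there is $r\in\mathcal{R}$ containing all hypotheses consistent with the evidence at termination; $\pi^*$ is a feasible policy of minimum cost (assumed to exist). The greedy HEC policy starts from $\mathcal{S}=\emptyset$ and repeatedly, while some test has $\Delta(t\mid\mathcal{S})>0$, runs a test maximizing $\Delta(t\mid\mathcal{S})$, observes its outcome $h(t)$ under the true hypothesis and adds $(t,h(t))$ to $\mathcal{S}$; it stops when all marginal gains are $0$. *)

theory Defs
  imports Complex_Main "HOL-Library.Multiset" "HOL-Library.FuncSet"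
begin

text \<open>Hypotheses are (extensional) functions from the test set to the outcome set.
  Evidence is a set of test/outcome pairs. Regions are sets of hypotheses.\<close>

definition regions_of :: "('t \<Rightarrow> 'b) set set \<Rightarrow> ('t \<Rightarrow> 'b) \<Rightarrow> ('t \<Rightarrow> 'b) set set" where
  "regions_of R h = {r \<in> R. h \<in> r}"

definition subregions :: "('t \<Rightarrow> 'b) set \<Rightarrow> ('t \<Rightarrow> 'b) set set \<Rightarrow> ('t \<Rightarrow> 'b) set set" where
  "subregions H R = (\<lambda>h. {h' \<in> H. regions_of R h' = regions_of R h}) ` H"

definition hec_k :: "('t \<Rightarrow> 'b) set \<Rightarrow> ('t \<Rightarrow> 'b) set set \<Rightarrow> nat" where
  "hec_k H R = min (Max ((\<lambda>h. card (regions_of R h)) ` H))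
                   (Max ((\<lambda>r. card {g \<in> subregions H R. g \<subseteq> r}) ` R)) + 1"

definition hec_edges :: "('t \<Rightarrow> 'b) set \<Rightarrow> ('t \<Rightarrow> 'b) set set \<Rightarrow> ('t \<Rightarrow> 'b) set multiset set" where
  "hec_edges H R = {e. set_mset e \<subseteq> subregions H R \<and> size e = hec_k H R
                        \<and> \<not> (\<exists>r\<in>R. \<forall>g\<in>#e. g \<subseteq> r)}"

definition prob_set :: "(('t \<Rightarrow> 'b) \<Rightarrow> real) \<Rightarrow> ('t \<Rightarrow> 'b) set \<Rightarrow> real" where
  "prob_set P A = (\<Sum>h\<in>A. P h)"

definition consistent :: "('t \<Rightarrow> 'b) set \<Rightarrow> ('t \<times> 'b) set \<Rightarrow> ('t \<Rightarrow> 'b) set" where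
  "consistent H S = {h \<in> H. \<forall>(t, v) \<in> S. h t = v}"

definition f_hec :: "('t \<Rightarrow> 'b) set \<Rightarrow> ('t \<Rightarrow> 'b) set set \<Rightarrow> (('t \<Rightarrow> 'b) \<Rightarrow> real)
                     \<Rightarrow> ('t \<times> 'b) set \<Rightarrow> real" where
  "f_hec H R P S =
     (\<Sum>e\<in>hec_edges H R. prod_mset (image_mset (prob_set P) e))
   - (\<Sum>e\<in>hec_edges H R. prod_mset (image_mset (\<lambda>g. prob_set P (g \<inter> consistent H S)) e))"

definition hec_gain :: "('t \<Rightarrow> 'b) set \<Rightarrow> ('t \<Rightarrow> 'b) set set \<Rightarrow> (('t \<Rightarrow> 'b) \<Rightarrow> real)
                        \<Rightarrow> 't \<Rightarrow> ('t \<times> 'b) set \<Rightarrow> real" where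
  "hec_gain H R P t S =
     (\<Sum>h\<in>consistent H S. P h / prob_set P (consistent H S)
        * (f_hec H R P (insert (t, h t) S) - f_hec H R P S))"

type_synonym ('t, 'b) policy = "('t \<times> 'b) set \<Rightarrow> 't option"

inductive runs :: "('t, 'b) policy \<Rightarrow> ('t \<Rightarrow> 'b) \<Rightarrow> ('t \<times> 'b) set \<Rightarrow> ('t \<times> 'b) set \<Rightarrow> bool"
  for pol h where
  stop: "pol S = None \<Longrightarrow> runs pol h S S"
| step: "pol S = Some t \<Longrightarrow> runs pol h (insert (t, h t) S) S' \<Longrightarrow> runs pol h S S'"

definition final_evidence :: "('t, 'b) policy \<Rightarrow> ('t \<Rightarrow> 'b) \<Rightarrow> ('t \<times> 'b) set" where
  "final_evidence pol h = (THE S'. runs pol h {} S')"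

definition policy_tests :: "('t, 'b) policy \<Rightarrow> ('t \<Rightarrow> 'b) \<Rightarrow> 't set" where
  "policy_tests pol h = fst ` final_evidence pol h"

definition policy_cost :: "('t \<Rightarrow> 'b) set \<Rightarrow> (('t \<Rightarrow> 'b) \<Rightarrow> real) \<Rightarrow> ('t, 'b) policy \<Rightarrow> real" where
  "policy_cost H P pol = (\<Sum>h\<in>H. P h * real (card (policy_tests pol h)))"

definition feasible :: "('t \<Rightarrow> 'b) set \<Rightarrow> ('t \<Rightarrow> 'b) set set \<Rightarrow> ('t, 'b) policy \<Rightarrow> bool" where
  "feasible H R pol \<longleftrightarrow>
     (\<forall>h\<in>H. (\<exists>S'. runs pol h {} S') \<and> (\<exists>r\<in>R. consistent H (final_evidence pol h) \<subseteq> r))"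

definition greedy_hec :: "'t set \<Rightarrow> ('t \<Rightarrow> 'b) set \<Rightarrow> ('t \<Rightarrow> 'b) set set \<Rightarrow> (('t \<Rightarrow> 'b) \<Rightarrow> real)
                          \<Rightarrow> ('t, 'b) policy \<Rightarrow> bool" where
  "greedy_hec T H R P pol \<longleftrightarrow>
     (\<forall>S. if (\<exists>t\<in>T. hec_gain H R P t S > 0)
          then (\<exists>t\<in>T. pol S = Some t \<and> (\<forall>t'\<in>T. hec_gain H R P t' S \<le> hec_gain H R P t S))
          else pol S = None)"

end

theory Submission
  imports Defs
begin

text \<open>Let w(V) be the total weight of the hyperedges restricted to the version space V, W = P(V) w(V),
  and let D(V) be the sum of P(h) times the optimal cost of h over h in V.  The choice of k makes the
  normalized expected gain of a test monotone in V, so telescoping along the optimal policy shows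
  that the greedy gain at V is at least W / D(V); moreover every positive gain is at least
  \<open>\<eta> = p_min ^ k\<close>.  Bounding the greedy cost below V by D (1 + ln W) plus a constant, as in the usual
  analysis, would only give the factor k + 1 in front of the logarithm.  Instead one uses
  the potential \<open>D (1 + ln (W / (\<eta> D)))\<close>, which compensates by relative entropy for the optimal cost
  being distributed over the branches differently from P.\<close>

section \<open>Products and sums over multisets\<close>

lemma prod_mset_le:
  fixes a b :: "'a \<Rightarrow> real"
  assumes "\<And>x. 0 \<le> a x" and "\<And>x. a x \<le> b x"
  shows "prod_mset (image_mset a e) \<le> prod_mset (image_mset b e)"
    and "0 \<le> prod_mset (image_mset a e)"
proof -
  have "prod_mset (image_mset a e) \<le> prod_mset (image_mset b e) \<and> 0 \<le> prod_mset (image_mset a e)"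
  proof (induction e)
    case (add x e)
    moreover have "0 \<le> b x" using assms[of x] by linarith
    ultimately show ?case
      using assms[of x] by (auto intro!: mult_mono)
  qed simp
  then show "prod_mset (image_mset a e) \<le> prod_mset (image_mset b e)"
    and "0 \<le> prod_mset (image_mset a e)" by auto
qed

text \<open>Writing \<open>(a x + d x) * A' - a x * A\<close> as
  \<open>a x * (A' - A) + d x * A'\<close> leaves only nonnegative quantities that grow with the
  base point. This is the source of the supermodularity of the edge weight.\<close>

lemma prod_mset_increment_mono:
  fixes a b d :: "'a \<Rightarrow> real"
  assumes "\<And>x. 0 \<le> a x" and "\<And>x. a x \<le> b x" and "\<And>x. 0 \<le> d x"
  shows "prod_mset (image_mset (\<lambda>x. a x + d x) e) - prod_mset (image_mset a e)
       \<le> prod_mset (image_mset (\<lambda>x. b x + d x) e) - prod_mset (image_mset b e)"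
proof (induction e)
  case (add x e)
  let ?A = "prod_mset (image_mset a e)" and ?A' = "prod_mset (image_mset (\<lambda>x. a x + d x) e)"
  let ?B = "prod_mset (image_mset b e)" and ?B' = "prod_mset (image_mset (\<lambda>x. b x + d x) e)"
  have bnn: "0 \<le> b x" for x
    using assms(1)[of x] assms(2)[of x] by linarith
  have "?B \<le> ?B'"
    by (rule prod_mset_le(1)) (auto simp: bnn assms(3))
  moreover have "?A' \<le> ?B'"
    by (rule prod_mset_le(1)) (auto simp: assms add_nonneg_nonneg)
  ultimately have "a x * (?A' - ?A) + d x * ?A' \<le> b x * (?B' - ?B) + d x * ?B'"
    using add.IH assms bnn
    by (intro add_mono order_trans[OF mult_left_mono mult_right_mono] mult_left_mono) auto
  then show ?case by (simp add: algebra_simps)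
qed simp

lemma prod_mset_ge_power:
  fixes a :: "'a \<Rightarrow> real"
  assumes "0 \<le> p" and "\<And>x. x \<in># e \<Longrightarrow> p \<le> a x"
  shows "p ^ size e \<le> prod_mset (image_mset a e)"
  using assms
proof (induction e)
  case (add x e)
  then have "p \<le> a x" "p ^ size e \<le> prod_mset (image_mset a e)" by auto
  then show ?case
    using add.prems(1) by (auto intro!: mult_mono)
qed simp

text \<open>In the multinomial expansion of the power every multiset has coefficient at least 1. The
  induction only uses that each multiset of size \<open>Suc n\<close> arises from some pair of an
  element and a multiset of size \<open>n\<close>.\<close>

lemma sum_multisets_of_size_le_power:
  fixes a :: "'a \<Rightarrow> real"
  assumes "finite A" and "\<And>x. 0 \<le> a x"
  shows "(\<Sum>e\<in>multisets_of_size A n. prod_mset (image_mset a e)) \<le> (\<Sum>x\<in>A. a x) ^ n"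
proof (induction n)
  case (Suc n)
  let ?m = "\<lambda>e. prod_mset (image_mset a e)"
  have nn: "0 \<le> ?m e" for e
    by (rule prod_mset_le(2)[where b = a]) (auto simp: assms)
  have sub: "multisets_of_size A (Suc n) \<subseteq> (\<lambda>(x, e). add_mset x e) ` (A \<times> multisets_of_size A n)"
  proof
    fix e assume e: "e \<in> multisets_of_size A (Suc n)"
    then obtain x e' where "e = add_mset x e'"
      by (auto simp: multisets_of_size_def dest: size_eq_Suc_imp_eq_union)
    then show "e \<in> (\<lambda>(x, e). add_mset x e) ` (A \<times> multisets_of_size A n)"
      using e by (intro image_eqI[of _ _ "(x, e')"]) (auto simp: multisets_of_size_def)
  qed
  have fin: "finite (A \<times> multisets_of_size A n)"
    using assms finite_multisets_of_size by blast
  have "sum ?m (multisets_of_size A (Suc n))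
      \<le> sum ?m ((\<lambda>(x, e). add_mset x e) ` (A \<times> multisets_of_size A n))"
    using sub fin nn by (intro sum_mono2) auto
  also have "\<dots> \<le> (\<Sum>z\<in>A \<times> multisets_of_size A n. (?m \<circ> (\<lambda>(x, e). add_mset x e)) z)"
    using fin nn by (intro sum_image_le) auto
  also have "\<dots> = (\<Sum>x\<in>A. a x) * sum ?m (multisets_of_size A n)"
    by (simp add: sum_product sum.cartesian_product case_prod_beta)
  also have "\<dots> \<le> (\<Sum>x\<in>A. a x) * (\<Sum>x\<in>A. a x) ^ n"
    using Suc assms by (intro mult_left_mono) (auto intro: sum_nonneg)
  finally show ?case by simp
qed simp

section \<open>Runs of policies\<close>

lemma runs_subset: "runs pol h S S' \<Longrightarrow> S \<subseteq> S'"
  by (induction rule: runs.induct) auto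

lemma runs_finite: "runs pol h S S' \<Longrightarrow> finite S \<Longrightarrow> finite S'"
  by (induction rule: runs.induct) auto

text \<open>Observing a recorded outcome again would leave the evidence unchanged, so the policy
  would loop; a terminating run must therefore enlarge its evidence at each test.\<close>

lemma runs_fresh: "runs pol h S S' \<Longrightarrow> pol S = Some t \<Longrightarrow> (t, h t) \<notin> S"
proof (induction rule: runs.induct)
  case (step S t' S')
  then have "t' = t" by simp
  then show ?case using step by (metis insert_absorb)
qed simp

lemma runs_unique: "runs pol h S S' \<Longrightarrow> runs pol h S S'' \<Longrightarrow> S'' = S'"
proof (induction rule: runs.induct)
  case (stop S)
  then show ?case by (auto elim: runs.cases)
next
  case (step S t S')
  from step.prems have "runs pol h (insert (t, h t) S) S''"
    using step.hyps(1) by (auto elim: runs.cases)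
  then show ?case by (rule step.IH)
qed

lemma final_evidence_eq: "runs pol h {} S' \<Longrightarrow> final_evidence pol h = S'"
  unfolding final_evidence_def by (rule the_equality) (auto dest: runs_unique)

lemma runs_evidence_true:
  "runs pol h S S' \<Longrightarrow> \<forall>(t, v)\<in>S. v = h t \<Longrightarrow> \<forall>(t, v)\<in>S'. v = h t"
  by (induction rule: runs.induct) auto

lemma card_policy_tests:
  assumes "runs pol h {} S'"
  shows "card (policy_tests pol h) = card S'"
proof -
  have "v = h t" if "(t, v) \<in> S'" for t v
    using runs_evidence_true[OF assms] that by blast
  then have "inj_on fst S'" by (intro inj_onI) (metis prod.collapse)
  then show ?thesis
    unfolding policy_tests_def final_evidence_eq[OF assms] by (rule card_image)
qed

section \<open>The amortization inequality\<close>

text \<open>One greedy test at a version space of probability \<open>A\<close>: \<open>W'\<close> is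
  the sum of \<open>W\<close> over the resulting branches. Passing from \<open>s\<close> to
  \<open>s * W' / W\<close> keeps \<open>W / s\<close> fixed, and the drop of
  \<open>D * ln s\<close> pays for \<open>A\<close> because \<open>cover\<close> says
  \<open>A \<le> D * (1 - x)\<close>. The truncation at 1 is where \<open>min_gain\<close> is
  needed.\<close>

lemma greedy_step_bound:
  fixes A D W W' \<eta> s :: real
  assumes cover: "A * W \<le> D * (W - W')" and min_gain: "\<eta> * A \<le> W - W'"
    and "0 < W" "0 \<le> W'" "0 \<le> D" "0 < \<eta>" "1 \<le> s"
  shows "A + D * ln (max 1 (s * W' / W)) + W' / (\<eta> * max 1 (s * W' / W)) \<le> D * ln s + W / (\<eta> * s)"
proof -
  define x where "x = W' / W"
  define a where "a = W / \<eta>"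
  have W': "W' = x * W" using assms by (simp add: x_def)
  have x: "0 \<le> x" using assms by (simp add: x_def)
  have "A * W \<le> (D * (1 - x)) * W" using cover by (simp add: W' algebra_simps)
  then have A1: "A \<le> D * (1 - x)" using \<open>0 < W\<close> by simp
  have "\<eta> * A \<le> \<eta> * (a * (1 - x))"
    using min_gain \<open>0 < \<eta>\<close> by (simp add: a_def W' right_diff_distrib)
       (simp add: algebra_simps)
  then have A2: "A \<le> a * (1 - x)" using \<open>0 < \<eta>\<close> by simp
  have sx: "s * W' / W = s * x" by (simp add: x_def)
  show ?thesis
  proof (cases "1 \<le> s * x")
    case True
    then have "0 < x" using x by (cases "x = 0") auto
    have "D * ln x \<le> D * (x - 1)"
      using \<open>0 < x\<close> \<open>0 \<le> D\<close> by (intro mult_left_mono ln_le_minus_one)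
    moreover have "ln (s * x) = ln s + ln x"
      using \<open>0 < x\<close> \<open>1 \<le> s\<close> by (simp add: ln_mult)
    moreover have "W' / (\<eta> * (s * x)) = W / (\<eta> * s)"
      using \<open>0 < x\<close> by (simp add: W')
    ultimately show ?thesis
      using True A1 unfolding sx by (simp add: max_def algebra_simps)
  next
    case False
    \<comment> \<open>\<open>u\<close> is the ratio at which the parameter reaches 1. The stretch
      from 1 down to \<open>u\<close> is paid by the cover bound, the rest down to \<open>x\<close>
      by the minimal gain; hence the weights \<open>1 - u\<close> and \<open>u - x\<close> for the
      two bounds on \<open>A\<close>.\<close>
    define u where "u = 1 / s"
    have u: "x < u" "u \<le> 1" using False \<open>1 \<le> s\<close> by (auto simp: u_def field_simps)
    have "A * (1 - u) \<le> D * (1 - x) * (1 - u)"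
      using A1 u by (intro mult_right_mono) auto
    moreover have "A * (u - x) \<le> a * (1 - x) * (u - x)"
      using A2 u by (intro mult_right_mono) auto
    ultimately have "A * (1 - x) \<le> (D * (1 - u) + a * (u - x)) * (1 - x)"
      by (simp add: algebra_simps)
    then have "A \<le> D * (1 - u) + a * (u - x)" using u by simp
    moreover have "1 - u \<le> ln s"
      using ln_le_minus_one[of u] \<open>1 \<le> s\<close> by (simp add: u_def ln_div)
    then have "D * (1 - u) \<le> D * ln s" using \<open>0 \<le> D\<close> by (rule mult_left_mono)
    moreover have "W' / \<eta> = a * x" "W / (\<eta> * s) = a * u"
      by (auto simp: a_def u_def W')
    ultimately show ?thesis
      using False unfolding sx by (simp add: max_def algebra_simps)
  qed
qed

section \<open>Edge weights\<close>

text \<open>A function of an arbitrary set of hypotheses rather than of evidence, so that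
  monotonicity can be proved by adding hypotheses one at a time.\<close>

definition hec_weight :: "('t \<Rightarrow> 'b) set \<Rightarrow> ('t \<Rightarrow> 'b) set set \<Rightarrow> (('t \<Rightarrow> 'b) \<Rightarrow> real)
                          \<Rightarrow> ('t \<Rightarrow> 'b) set \<Rightarrow> real" where
  "hec_weight H R P V =
     (\<Sum>e\<in>hec_edges H R. prod_mset (image_mset (\<lambda>g. prob_set P (g \<inter> V)) e))"

locale hec_instance =
  fixes H :: "('t \<Rightarrow> 'b) set" and R :: "('t \<Rightarrow> 'b) set set" and P :: "('t \<Rightarrow> 'b) \<Rightarrow> real"
  assumes finite_H: "finite H" and finite_R: "finite R"
    and P_pos: "h \<in> H \<Longrightarrow> 0 < P h"
    and R_cover: "\<Union>R = H"
begin

abbreviation "G \<equiv> subregions H R"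
abbreviation "E \<equiv> hec_edges H R"
abbreviation "k \<equiv> hec_k H R"
abbreviation "w \<equiv> hec_weight H R P"
abbreviation "edge_wt V e \<equiv> prod_mset (image_mset (\<lambda>g. prob_set P (g \<inter> V)) e)"

section \<open>Subregions and exchange in hyperedges\<close>

definition cls :: "('t \<Rightarrow> 'b) \<Rightarrow> ('t \<Rightarrow> 'b) set" where
  "cls h = {h' \<in> H. regions_of R h' = regions_of R h}"

lemma subregions_eq: "G = cls ` H"
  by (auto simp: subregions_def cls_def)

lemma finite_G: "finite G"
  using finite_H by (simp add: subregions_eq)

lemma cls_mem: "h \<in> H \<Longrightarrow> h \<in> cls h" "h \<in> H \<Longrightarrow> cls h \<in> G"
  by (auto simp: cls_def subregions_eq)

lemma mem_subregion_iff: "g \<in> G \<Longrightarrow> h \<in> H \<Longrightarrow> h \<in> g \<longleftrightarrow> g = cls h"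
  by (auto simp: cls_def subregions_eq)

lemma subregion_subset_region: "g \<in> G \<Longrightarrow> r \<in> R \<Longrightarrow> h \<in> g \<Longrightarrow> h \<in> r \<Longrightarrow> g \<subseteq> r"
  by (auto simp: cls_def subregions_eq regions_of_def)

lemma edges_subset: "E \<subseteq> multisets_of_size G k"
  by (auto simp: hec_edges_def multisets_of_size_def)

lemma finite_E: "finite E"
  using finite_subset[OF edges_subset finite_multisets_of_size[OF finite_G]] .

text \<open>This is where the value of k enters: if every replacement failed, k pairwise distinct
  regions would contain g, and one of them would contain k distinct subregions.\<close>
lemma edge_exchange:
  assumes e: "e \<in> E" and g: "g \<in> G"
  shows "\<exists>x\<in>#e. add_mset g (e - {#x#}) \<in> E"
proof (rule ccontr)
  assume contra: "\<not> ?thesis"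
  have e': "set_mset e \<subseteq> G" "size e = k" "\<And>r. r \<in> R \<Longrightarrow> \<exists>y\<in>#e. \<not> y \<subseteq> r"
    using e by (auto simp: hec_edges_def)
  have "\<exists>r\<in>R. g \<subseteq> r \<and> (\<forall>y\<in>#e - {#x#}. y \<subseteq> r)" if x: "x \<in># e" for x
  proof -
    have "set_mset (add_mset g (e - {#x#})) \<subseteq> G"
      using e' g by (auto dest: in_diffD)
    moreover have "size (add_mset g (e - {#x#})) = k"
      using e' x by (metis size_add_mset insert_DiffM)
    ultimately show ?thesis
      using contra x by (auto simp: hec_edges_def)
  qed
  \<comment> \<open>\<open>r x\<close> is the region that prevents the exchange of \<open>x\<close>
    for \<open>g\<close> from giving an edge.\<close>
  then obtain r where r: "\<And>x. x \<in># e \<Longrightarrow> r x \<in> R \<and> g \<subseteq> r x \<and> (\<forall>y\<in>#e - {#x#}. y \<subseteq> r x)"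
    by metis
  have not_sub: "\<not> x \<subseteq> r x" if x: "x \<in># e" for x
  proof
    assume "x \<subseteq> r x"
    then have "\<forall>y\<in>#e. y \<subseteq> r x"
      using r[OF x] x by (metis insert_DiffM insert_noteq_member)
    then show False using e'(3)[of "r x"] r[OF x] by blast
  qed
  have sub: "y \<subseteq> r x" if "x \<in># e" "y \<in># e" "x \<noteq> y" for x y
  proof -
    have "y \<in># e - {#x#}" using that by (simp add: in_diff_count)
    then show ?thesis using r[OF that(1)] by blast
  qed
  \<comment> \<open>A second copy of \<open>x\<close> would survive in \<open>e - {#x#}\<close> and
    hence lie in \<open>r x\<close>.\<close>
  have "count e x = 1" if x: "x \<in># e" for x
  proof -
    have "x \<notin># e - {#x#}" using r[OF x] not_sub[OF x] by blast
    then have "count e x \<le> 1" by (simp add: in_diff_count)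
    moreover have "0 < count e x" using x by simp
    ultimately show ?thesis by linarith
  qed
  then have card_e: "card (set_mset e) = k"
    using e'(2) by (simp add: size_multiset_overloaded_eq)
  have inj: "inj_on r (set_mset e)"
  proof (rule inj_onI, rule ccontr)
    fix x y assume "x \<in># e" "y \<in># e" "r x = r y" "x \<noteq> y"
    then show False using not_sub[of y] sub[of x y] by simp
  qed
  obtain h where h: "h \<in> H" "h \<in> g"
    using g cls_mem by (auto simp: subregions_eq)
  have "r ` set_mset e \<subseteq> regions_of R h"
    using r h by (auto simp: regions_of_def)
  then have "k \<le> card (regions_of R h)"
    using card_image[OF inj] card_e card_mono[of "regions_of R h" "r ` set_mset e"] finite_R
    by (simp add: regions_of_def)
  also have "\<dots> \<le> Max ((\<lambda>h. card (regions_of R h)) ` H)"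
    using finite_H h by simp
  finally have 1: "k \<le> Max ((\<lambda>h. card (regions_of R h)) ` H)" .
  have "e \<noteq> {#}" using e'(2) by (auto simp: hec_k_def)
  then obtain x where x: "x \<in># e" by blast
  have "g \<notin> set_mset e - {x}"
  proof
    assume "g \<in> set_mset e - {x}"
    then have "g \<in># e" by blast
    then show False using not_sub[of g] r[of g] by blast
  qed
  then have "card (insert g (set_mset e - {x})) = k"
    using x card_e by (metis card_Suc_Diff1 card_insert_disjoint finite_Diff finite_set_mset)
  moreover have "insert g (set_mset e - {x}) \<subseteq> {g \<in> G. g \<subseteq> r x}"
    using r[OF x] sub[OF x] g e' by auto
  then have "card (insert g (set_mset e - {x})) \<le> card {g \<in> G. g \<subseteq> r x}"
    using finite_G by (intro card_mono) auto
  ultimately have "k \<le> card {g \<in> G. g \<subseteq> r x}" by simp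
  also have "\<dots> \<le> Max ((\<lambda>r. card {g \<in> G. g \<subseteq> r}) ` R)"
    using finite_R r[OF x] by (intro Max_ge) auto
  finally have "k \<le> Max ((\<lambda>r. card {g \<in> G. g \<subseteq> r}) ` R)" .
  \<comment> \<open>\<open>k\<close> exceeds the smaller of the two maxima by one, so it cannot be
    bounded by both.\<close>
  then show False using 1 by (simp add: hec_k_def)
qed

section \<open>Probabilities of sets of hypotheses\<close>

lemma prob_set_nonneg: "U \<subseteq> H \<Longrightarrow> 0 \<le> prob_set P U"
  unfolding prob_set_def using P_pos by (intro sum_nonneg) (auto simp: less_imp_le subset_iff)

lemma prob_set_pos: "U \<subseteq> H \<Longrightarrow> U \<noteq> {} \<Longrightarrow> 0 < prob_set P U"
  unfolding prob_set_def using P_pos finite_subset[OF _ finite_H]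
  by (intro sum_pos) (auto simp: subset_iff)

lemma prob_set_mono: "U \<subseteq> V \<Longrightarrow> V \<subseteq> H \<Longrightarrow> prob_set P U \<le> prob_set P V"
  unfolding prob_set_def using P_pos finite_subset[OF _ finite_H]
  by (intro sum_mono2) (auto simp: subset_iff less_imp_le)

lemma prob_set_insert_Int:
  assumes "U \<subseteq> H" "h \<notin> U"
  shows "prob_set P (g \<inter> insert h U) = prob_set P (g \<inter> U) + (if h \<in> g then P h else 0)"
proof -
  have "finite (g \<inter> U)" using assms finite_H finite_subset by blast
  then show ?thesis using assms by (auto simp: prob_set_def Int_insert_right)
qed

lemma prob_set_insert: "U \<subseteq> H \<Longrightarrow> h \<notin> U \<Longrightarrow> prob_set P (insert h U) = prob_set P U + P h"
  using prob_set_insert_Int[of U h UNIV] by simp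

lemma prob_set_partition:
  assumes "U \<subseteq> H"
  shows "prob_set P U = (\<Sum>x\<in>G. prob_set P (x \<inter> U))"
proof -
  have fin: "finite U" using assms finite_H finite_subset by blast
  have "prob_set P U = (\<Sum>x\<in>cls ` U. sum P {h \<in> U. cls h = x})"
    unfolding prob_set_def by (rule sum.image_gen[OF fin])
  also have "\<dots> = (\<Sum>x\<in>cls ` U. prob_set P (x \<inter> U))"
    using assms by (intro sum.cong)
      (auto simp: prob_set_def mem_subregion_iff[OF cls_mem(2)] subset_iff intro!: sum.cong)
  also have "\<dots> = (\<Sum>x\<in>G. prob_set P (x \<inter> U))"
  proof (rule sum.mono_neutral_left[OF finite_G])
    show "cls ` U \<subseteq> G" using assms by (auto simp: subregions_eq)
    show "\<forall>x\<in>G - cls ` U. prob_set P (x \<inter> U) = 0"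
    proof
      fix x assume x: "x \<in> G - cls ` U"
      then have "x \<inter> U = {}" using assms mem_subregion_iff[of x] by blast
      then show "prob_set P (x \<inter> U) = 0" by (simp add: prob_set_def)
    qed
  qed
  finally show ?thesis .
qed

section \<open>Growth of the edge weight when hypotheses are added\<close>

lemma edge_wt_nonneg: "U \<subseteq> H \<Longrightarrow> 0 \<le> edge_wt U e"
  by (rule prod_mset_le(2)[where b = "\<lambda>g. prob_set P (g \<inter> U)"]) (auto intro!: prob_set_nonneg)

lemma edge_wt_mono: "U \<subseteq> V \<Longrightarrow> V \<subseteq> H \<Longrightarrow> edge_wt U e \<le> edge_wt V e"
  by (rule prod_mset_le(1)) (auto intro!: prob_set_nonneg prob_set_mono)

lemma weight_nonneg: "U \<subseteq> H \<Longrightarrow> 0 \<le> w U"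
  unfolding hec_weight_def by (intro sum_nonneg edge_wt_nonneg)

lemma weight_mono: "U \<subseteq> V \<Longrightarrow> V \<subseteq> H \<Longrightarrow> w U \<le> w V"
  unfolding hec_weight_def by (intro sum_mono edge_wt_mono)

text \<open>Each edge has a subregion not contained in \<open>r\<close>; such a subregion is
  disjoint from \<open>r\<close>, so its factor vanishes. This is what feasibility yields at the end
  of a run.\<close>

lemma weight_in_region:
  assumes "r \<in> R" "U \<subseteq> r" "U \<subseteq> H"
  shows "w U = 0"
  unfolding hec_weight_def
proof (rule sum.neutral, rule ballI)
  fix e assume "e \<in> E"
  then obtain g where g: "g \<in># e" "\<not> g \<subseteq> r" "g \<in> G"
    using assms(1) unfolding hec_edges_def by blast
  then have "g \<inter> U = {}"
    using assms subregion_subset_region[of g r] by blast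
  then have "prob_set P (g \<inter> U) = 0" by (simp add: prob_set_def)
  then show "edge_wt U e = 0"
    using g(1) by (auto simp: prod_mset_zero_iff)
qed

text \<open>Supermodularity: adding \<open>h\<close> raises each factor by an amount that does not
  depend on the set it is added to.\<close>

lemma weight_increment_mono:
  assumes "U \<subseteq> V" "V \<subseteq> H" "h \<in> H" "h \<notin> V"
  shows "w (insert h U) - w U \<le> w (insert h V) - w V"
proof -
  have "edge_wt (insert h U) e - edge_wt U e \<le> edge_wt (insert h V) e - edge_wt V e" for e
  proof -
    have U: "U \<subseteq> H" "h \<notin> U" using assms by auto
    show ?thesis
      unfolding prob_set_insert_Int[OF U] prob_set_insert_Int[OF assms(2,4)]
      using assms U P_pos[OF assms(3)]
      by (intro prod_mset_increment_mono) (auto intro!: prob_set_nonneg prob_set_mono)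
  qed
  then show ?thesis
    unfolding hec_weight_def sum_subtractf[symmetric] by (rule sum_mono)
qed

text \<open>One copy of \<open>g\<close> gains \<open>P h\<close>, and the remaining factors do not
  decrease.\<close>

lemma edge_wt_insert_diff:
  assumes U: "U \<subseteq> H" and h: "h \<in> H" "h \<notin> U" and g: "h \<in> g" "g \<in># e"
  shows "P h * edge_wt (insert h U) (e - {#g#}) \<le> edge_wt (insert h U) e - edge_wt U e"
proof -
  let ?e = "e - {#g#}"
  have V: "insert h U \<subseteq> H" using U h by auto
  have e: "e = add_mset g ?e" using g(2) by simp
  have "prob_set P (g \<inter> U) * edge_wt U ?e \<le> prob_set P (g \<inter> U) * edge_wt (insert h U) ?e"
    using U V by (intro mult_left_mono edge_wt_mono prob_set_nonneg) auto
  moreover have "edge_wt U e = prob_set P (g \<inter> U) * edge_wt U ?e"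
    by (subst e) simp
  moreover have "edge_wt (insert h U) e
      = (prob_set P (g \<inter> U) + P h) * edge_wt (insert h U) ?e"
    using prob_set_insert_Int[OF U h(2), of g] g(1) by (subst e) simp
  ultimately show ?thesis by (simp add: algebra_simps)
qed

text \<open>In the continuous picture this says that the logarithmic derivative of the weight in the
  direction of any hypothesis is at least that of the total probability.  The exchange property
  maps an edge e to the pair of the removed subregion and the resulting edge, injectively.\<close>
lemma weight_insert_ge:
  assumes U: "U \<subseteq> H" and h: "h \<in> H" "h \<notin> U"
  shows "P h * w U \<le> prob_set P U * (w (insert h U) - w U)"
proof -
  define g where "g = cls h"
  define Eg where "Eg = {e \<in> E. g \<in># e}"
  have V: "insert h U \<subseteq> H" using U h by auto
  have g: "g \<in> G" "h \<in> g" using cls_mem h by (auto simp: g_def)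
  obtain x where x: "\<And>e. e \<in> E \<Longrightarrow> x e \<in># e \<and> add_mset g (e - {#x e#}) \<in> E"
    using edge_exchange[OF _ g(1)] by metis
  define \<phi> where "\<phi> e = (x e, add_mset g (e - {#x e#}))" for e
  let ?v = "\<lambda>(y, e). prob_set P (y \<inter> U) * edge_wt U (e - {#g#})"
  have inj: "inj_on \<phi> E"
  proof (rule inj_onI)
    fix e e' assume "e \<in> E" "e' \<in> E" "\<phi> e = \<phi> e'"
    then show "e = e'" using x[of e] x[of e'] by (simp add: \<phi>_def) (metis insert_DiffM)
  qed
  have sub: "\<phi> ` E \<subseteq> G \<times> Eg"
  proof
    fix z assume "z \<in> \<phi> ` E"
    then obtain e where e: "e \<in> E" "z = \<phi> e" by blast
    then have "x e \<in> G" using x[OF e(1)] unfolding hec_edges_def by blast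
    then show "z \<in> G \<times> Eg" using x[OF e(1)] e(2) by (simp add: \<phi>_def Eg_def)
  qed
  \<comment> \<open>\<open>?v\<close> takes \<open>g\<close> off the exchanged edge again and
    multiplies by the factor of the removed subregion, which restores the weight of
    \<open>e\<close>.\<close>
  have "w U = (\<Sum>e\<in>E. ?v (\<phi> e))"
    unfolding hec_weight_def
  proof (rule sum.cong[OF refl])
    fix e assume "e \<in> E"
    then have "add_mset (x e) (e - {#x e#}) = e" using x by simp
    then have "edge_wt U e = edge_wt U (add_mset (x e) (e - {#x e#}))" by (rule arg_cong[OF sym])
    then show "edge_wt U e = ?v (\<phi> e)" by (simp add: \<phi>_def)
  qed
  also have "\<dots> = sum ?v (\<phi> ` E)"
    using sum.reindex[OF inj, of ?v] by simp
  \<comment> \<open>Pairs outside the image of \<open>\<phi>\<close> contribute nonnegative terms,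
    and over the full product the sum factorizes.\<close>
  also have "\<dots> \<le> sum ?v (G \<times> Eg)"
    using sub finite_G finite_E U
    by (intro sum_mono2) (auto simp: Eg_def intro!: mult_nonneg_nonneg prob_set_nonneg edge_wt_nonneg)
  also have "\<dots> = prob_set P U * (\<Sum>e\<in>Eg. edge_wt U (e - {#g#}))"
    unfolding prob_set_partition[OF U] sum_product sum.cartesian_product by simp
  finally have "P h * w U \<le> P h * (prob_set P U * (\<Sum>e\<in>Eg. edge_wt U (e - {#g#})))"
    using P_pos[OF h(1)] by simp
  also have "\<dots> = prob_set P U * (\<Sum>e\<in>Eg. P h * edge_wt U (e - {#g#}))"
    by (simp add: sum_distrib_left mult.left_commute)
  also have "\<dots> \<le> prob_set P U * (\<Sum>e\<in>Eg. edge_wt (insert h U) e - edge_wt U e)"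
  proof (intro mult_left_mono sum_mono)
    fix e assume "e \<in> Eg"
    then have "P h * edge_wt (insert h U) (e - {#g#}) \<le> edge_wt (insert h U) e - edge_wt U e"
      using edge_wt_insert_diff[OF U h g(2)] by (auto simp: Eg_def)
    moreover have "P h * edge_wt U (e - {#g#}) \<le> P h * edge_wt (insert h U) (e - {#g#})"
      using P_pos[OF h(1)] V by (intro mult_left_mono edge_wt_mono) auto
    ultimately show "P h * edge_wt U (e - {#g#}) \<le> edge_wt (insert h U) e - edge_wt U e" by simp
  qed (use U prob_set_nonneg in auto)
  also have "\<dots> \<le> prob_set P U * (\<Sum>e\<in>E. edge_wt (insert h U) e - edge_wt U e)"
    using U V finite_E edge_wt_mono[of U "insert h U"]
    by (intro mult_left_mono sum_mono2 prob_set_nonneg) (auto simp: Eg_def)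
  finally show ?thesis by (simp add: hec_weight_def sum_subtractf)
qed

text \<open>Source of the minimal gain. Exchanging the subregion of a lost hypothesis
  \<open>h\<close> into an edge of nonzero weight leaves \<open>k - 1\<close> other factors, each at
  least \<open>p\<close>, and losing \<open>h\<close> lowers the factor of its own subregion by at
  least \<open>p\<close>.\<close>

lemma weight_drop_ge:
  assumes V: "V \<subseteq> H" "0 < w V" and U: "U \<subset> V" and p: "0 < p" "\<forall>h\<in>H. p \<le> P h"
  shows "p ^ k \<le> w V - w U"
proof -
  obtain h where h: "h \<in> V" "h \<notin> U" using U by blast
  define V' where "V' = V - {h}"
  have V': "V' \<subseteq> H" "h \<notin> V'" "insert h V' = V" "h \<in> H" "U \<subseteq> V'"
    using h V U by (auto simp: V'_def)
  define g where "g = cls h"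
  have g: "g \<in> G" "h \<in> g" using cls_mem V' by (auto simp: g_def)
  have "\<exists>e\<in>E. edge_wt V e \<noteq> 0"
    using V(2) unfolding hec_weight_def by (metis less_irrefl sum.neutral)
  then obtain e where e: "e \<in> E" "edge_wt V e \<noteq> 0" by blast
  obtain x where x: "x \<in># e" "add_mset g (e - {#x#}) \<in> E"
    using edge_exchange[OF e(1) g(1)] by blast
  let ?e = "add_mset g (e - {#x#})"
  have "p ^ size (e - {#x#}) \<le> edge_wt V (e - {#x#})"
  proof (rule prod_mset_ge_power)
    fix y assume "y \<in># e - {#x#}"
    then have "y \<in># e" by (rule in_diffD)
    then have "prob_set P (y \<inter> V) \<noteq> 0"
      using e(2) by (auto simp: prod_mset_zero_iff)
    then have "y \<inter> V \<noteq> {}" by (metis prob_set_def sum.empty)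
    then obtain h' where "h' \<in> y \<inter> V" by blast
    then have "P h' \<le> prob_set P (y \<inter> V)"
      using prob_set_mono[of "{h'}" "y \<inter> V"] V(1) by (auto simp: prob_set_def)
    moreover have "p \<le> P h'" using p(2) \<open>h' \<in> y \<inter> V\<close> V(1) by blast
    ultimately show "p \<le> prob_set P (y \<inter> V)" by linarith
  qed (use p in simp)
  then have "p * p ^ size (e - {#x#}) \<le> P h * edge_wt V (e - {#x#})"
    using p V' P_pos[of h] by (intro mult_mono) (auto simp: less_imp_le)
  moreover have "p * p ^ size (e - {#x#}) = p ^ k"
  proof -
    have "size ?e = k" using x(2) by (auto simp: hec_edges_def)
    then have "k = Suc (size (e - {#x#}))" by simp
    then show ?thesis by simp
  qed
  moreover have "P h * edge_wt V (e - {#x#}) \<le> edge_wt V ?e - edge_wt V' ?e"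
    using edge_wt_insert_diff[OF V'(1,4,2) g(2), of ?e] V'(3) by simp
  moreover have "edge_wt V ?e - edge_wt V' ?e \<le> (\<Sum>e\<in>E. edge_wt V e - edge_wt V' e)"
    using x(2) finite_E V' V(1) by (intro member_le_sum) (auto intro: edge_wt_mono)
  moreover have "w U \<le> w V'" using V' by (intro weight_mono)
  ultimately show ?thesis by (simp add: hec_weight_def sum_subtractf)
qed

text \<open>All multisets of size \<open>k\<close>, edges or not, together weigh at most the
  \<open>k\<close>-th power of the total probability of the subregions.\<close>

lemma weight_le_1:
  assumes "prob_set P H = 1"
  shows "w H \<le> 1"
proof -
  let ?a = "\<lambda>g. prob_set P (g \<inter> H)"
  have nn: "0 \<le> ?a g" for g by (auto intro!: prob_set_nonneg)
  have "w H \<le> (\<Sum>e\<in>multisets_of_size G k. edge_wt H e)"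
    unfolding hec_weight_def using edges_subset finite_multisets_of_size[OF finite_G]
    by (intro sum_mono2) (auto intro: edge_wt_nonneg)
  also have "\<dots> \<le> (\<Sum>g\<in>G. ?a g) ^ k"
    using finite_G nn by (rule sum_multisets_of_size_le_power)
  also have "\<dots> = 1" using prob_set_partition[of H] assms by simp
  finally show ?thesis .
qed

section \<open>Expected gains\<close>

definition sel :: "('t \<Rightarrow> 'b) set \<Rightarrow> 't \<Rightarrow> 'b \<Rightarrow> ('t \<Rightarrow> 'b) set" where
  "sel U t v = {h \<in> U. h t = v}"

text \<open>Grouped by outcomes this is the sum of probability times weight over the branches of
  \<open>t\<close>. It is deliberately not normalized, which makes it additive.\<close>

definition split_weight :: "'t \<Rightarrow> ('t \<Rightarrow> 'b) set \<Rightarrow> real" where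
  "split_weight t U = (\<Sum>h\<in>U. P h * w (sel U t (h t)))"

definition gain :: "'t \<Rightarrow> ('t \<Rightarrow> 'b) set \<Rightarrow> real" where
  "gain t U = w U - split_weight t U / prob_set P U"

lemma sel_subset: "sel U t v \<subseteq> U"
  by (auto simp: sel_def)

lemma sum_sel:
  assumes "U \<subseteq> H"
  shows "sum f U = (\<Sum>v\<in>(\<lambda>h. h t) ` U. sum f (sel U t v))"
proof -
  have "finite U" using assms finite_H finite_subset by blast
  from sum.image_gen[OF this, of f "\<lambda>h. h t"] show ?thesis by (simp add: sel_def)
qed

lemma split_weight_eq:
  assumes "U \<subseteq> H"
  shows "split_weight t U = (\<Sum>v\<in>(\<lambda>h. h t) ` U. prob_set P (sel U t v) * w (sel U t v))"
  unfolding split_weight_def sum_sel[OF assms, of _ t]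
  by (intro sum.cong) (auto simp: sel_def prob_set_def sum_distrib_right)

lemma split_weight_nonneg: "U \<subseteq> H \<Longrightarrow> 0 \<le> split_weight t U"
  unfolding split_weight_def using P_pos sel_subset
  by (intro sum_nonneg mult_nonneg_nonneg weight_nonneg) (auto simp: less_imp_le subset_iff sel_def)

lemma prob_times_gain:
  "U \<subseteq> H \<Longrightarrow> U \<noteq> {} \<Longrightarrow> prob_set P U * gain t U = prob_set P U * w U - split_weight t U"
  using prob_set_pos[of U] by (simp add: gain_def right_diff_distrib)

lemma gain_le_weight: "U \<subseteq> H \<Longrightarrow> gain t U \<le> w U"
  using split_weight_nonneg[of U t] prob_set_nonneg[of U] by (simp add: gain_def)

lemma gain_constant:
  assumes "U \<subseteq> H" "\<And>h. h \<in> U \<Longrightarrow> h t = v" "U \<noteq> {}"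
  shows "gain t U = 0"
proof -
  have "sel U t (h t) = U" if "h \<in> U" for h using assms(2) that by (auto simp: sel_def)
  then have "split_weight t U = prob_set P U * w U"
    by (simp add: split_weight_def prob_set_def sum_distrib_right)
  then show ?thesis using prob_times_gain[OF assms(1,3), of t] prob_set_pos[OF assms(1,3)] by simp
qed

text \<open>Only the branch \<open>Uo\<close> of \<open>h\<close> changes; the others keep their
  contribution \<open>c\<close>, now divided by a larger probability. For the changed branch,
  supermodularity compares the increments \<open>\<delta>o\<close> and \<open>\<delta>\<close>, and
  \<open>weight_insert_ge\<close> shows that \<open>\<delta>\<close> outweighs the shift of
  probability towards that branch.\<close>

lemma gain_le_gain_insert:
  assumes U: "U \<subseteq> H" "U \<noteq> {}" and h: "h \<in> H" "h \<notin> U"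
  shows "gain t U \<le> gain t (insert h U)"
proof -
  define V where "V = insert h U"
  define Uo where "Uo = sel U t (h t)"
  define C where "C = {h' \<in> U. h' t \<noteq> h t}"
  define c where "c = (\<Sum>h'\<in>C. P h' * w (sel U t (h' t)))"
  have fin: "finite U" using U finite_H finite_subset by blast
  have V: "V \<subseteq> H" using U h by (auto simp: V_def)
  have Uo: "Uo \<subseteq> U" "Uo \<subseteq> H" "h \<notin> Uo" using U h by (auto simp: Uo_def sel_def)
  have parts: "U = Uo \<union> C" "Uo \<inter> C = {}" "finite Uo" "finite C" "h \<notin> C"
    using fin h by (auto simp: Uo_def C_def sel_def)
  have selV: "sel V t (h t) = insert h Uo" "\<And>h'. h' \<in> C \<Longrightarrow> sel V t (h' t) = sel U t (h' t)"
    by (auto simp: V_def Uo_def C_def sel_def)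
  have split_U: "split_weight t U = prob_set P Uo * w Uo + c"
  proof -
    have "split_weight t U = (\<Sum>h'\<in>Uo. P h' * w (sel U t (h' t))) + c"
      using sum.union_disjoint[OF parts(3,4,2), of "\<lambda>h'. P h' * w (sel U t (h' t))"] parts(1)
      by (simp add: split_weight_def c_def)
    moreover have "(\<Sum>h'\<in>Uo. P h' * w (sel U t (h' t))) = prob_set P Uo * w Uo"
      unfolding prob_set_def sum_distrib_right
      by (intro sum.cong) (auto simp: Uo_def sel_def)
    ultimately show ?thesis by simp
  qed
  have split_V: "split_weight t V = (prob_set P Uo + P h) * w (insert h Uo) + c"
  proof -
    have "V = insert h Uo \<union> C" using parts(1) by (auto simp: V_def)
    then have "split_weight t V = (\<Sum>h'\<in>insert h Uo. P h' * w (sel V t (h' t)))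
        + (\<Sum>h'\<in>C. P h' * w (sel V t (h' t)))"
      using sum.union_disjoint[of "insert h Uo" C "\<lambda>h'. P h' * w (sel V t (h' t))"] parts
      by (simp add: split_weight_def)
    moreover have "(\<Sum>h'\<in>C. P h' * w (sel V t (h' t))) = c"
      by (simp add: c_def selV(2))
    moreover have "(\<Sum>h'\<in>insert h Uo. P h' * w (sel V t (h' t)))
        = prob_set P (insert h Uo) * w (insert h Uo)"
      unfolding prob_set_def sum_distrib_right selV(1)[symmetric]
      by (intro sum.cong) (auto simp: V_def Uo_def sel_def)
    ultimately show ?thesis using prob_set_insert[OF Uo(2,3)] by simp
  qed
  define A where "A = prob_set P U"
  define Ao where "Ao = prob_set P Uo"
  define p where "p = P h"
  define \<delta> where "\<delta> = w V - w U"
  define \<delta>o where "\<delta>o = w (insert h Uo) - w Uo"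
  define q where "q = w Uo / A"
  have pos: "0 < A" "0 < p" "0 \<le> Ao" "Ao \<le> A"
    using U h Uo P_pos prob_set_pos prob_set_nonneg prob_set_mono by (auto simp: A_def p_def Ao_def)
  have c: "0 \<le> c"
    unfolding c_def using P_pos U
    by (intro sum_nonneg mult_nonneg_nonneg weight_nonneg)
      (auto simp: C_def sel_def less_imp_le subset_iff)
  have \<delta>: "\<delta>o \<le> \<delta>"
    using weight_increment_mono[OF Uo(1) U(1) h] by (simp add: \<delta>_def \<delta>o_def V_def)
  have "p * w Uo \<le> p * w U"
    using weight_mono[OF Uo(1) U(1)] pos by simp
  also have "\<dots> \<le> A * \<delta>"
    using weight_insert_ge[OF U(1) h] by (simp add: A_def p_def \<delta>_def V_def)
  finally have "p * q \<le> \<delta>"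
    using pos by (simp add: q_def field_simps)
  then have 1: "(A - Ao) * (p * q) \<le> (A - Ao) * \<delta>"
    using pos by (intro mult_left_mono) auto
  have 2: "(Ao + p) * \<delta>o \<le> (Ao + p) * \<delta>"
    using pos \<delta> by (intro mult_left_mono) auto
  \<comment> \<open>After cancelling \<open>Ao * q * A\<close> this is the sum of inequalities 1 and
    2.\<close>
  have "(Ao + p) * (q * A + \<delta>o) \<le> (\<delta> + Ao * q) * (A + p)"
    using 1 2 by (simp add: algebra_simps)
  then have "(Ao + p) * (q * A + \<delta>o) / (A + p) \<le> \<delta> + Ao * q"
    using pos by (simp add: pos_divide_le_eq)
  moreover have "c / (A + p) \<le> c / A"
    using pos c by (intro divide_left_mono) auto
  moreover have "w (insert h Uo) = q * A + \<delta>o"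
    using pos by (simp add: q_def \<delta>o_def)
  moreover have "prob_set P V = A + p"
    using prob_set_insert[OF U(1) h(2)] by (simp add: V_def A_def p_def)
  moreover have "Ao * w Uo / A = Ao * q" by (simp add: q_def)
  ultimately have "w U - (Ao * w Uo + c) / A
      \<le> w V - ((Ao + p) * w (insert h Uo) + c) / prob_set P V"
    by (simp add: add_divide_distrib \<delta>_def)
  then show ?thesis
    using split_U split_V by (simp add: gain_def A_def Ao_def p_def V_def)
qed

lemma gain_mono:
  assumes "U \<subseteq> V" "V \<subseteq> H" "U \<noteq> {}"
  shows "gain t U \<le> gain t V"
proof -
  have "finite D \<Longrightarrow> D \<subseteq> H - U \<Longrightarrow> gain t U \<le> gain t (U \<union> D)" for D
  proof (induction D rule: finite_induct)
    case (insert h D)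
    then have "gain t U \<le> gain t (U \<union> D)" by simp
    also have "\<dots> \<le> gain t (insert h (U \<union> D))"
      using insert assms by (intro gain_le_gain_insert) auto
    finally show ?case by simp
  qed simp
  from this[of "V - U"] show ?thesis
    using assms finite_subset[OF _ finite_H, of "V - U"] by (auto simp: Un_absorb1)
qed

section \<open>Translation from evidence to version spaces\<close>

lemma f_hec_eq: "f_hec H R P S = (\<Sum>e\<in>E. prod_mset (image_mset (prob_set P) e)) - w (consistent H S)"
  by (simp add: f_hec_def hec_weight_def)

lemma consistent_subset: "consistent H S \<subseteq> H"
  by (auto simp: consistent_def)

lemma consistent_insert: "consistent H (insert (t, v) S) = sel (consistent H S) t v"
  by (auto simp: consistent_def sel_def)

lemma hec_gain_eq:
  assumes "consistent H S \<noteq> {}"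
  shows "hec_gain H R P t S = gain t (consistent H S)"
proof -
  let ?V = "consistent H S"
  have A: "0 < prob_set P ?V" using prob_set_pos[OF consistent_subset assms] .
  have "hec_gain H R P t S = (\<Sum>h\<in>?V. P h * (w ?V - w (sel ?V t (h t)))) / prob_set P ?V"
    by (simp add: hec_gain_def f_hec_eq consistent_insert sum_divide_distrib)
  also have "(\<Sum>h\<in>?V. P h * (w ?V - w (sel ?V t (h t)))) = prob_set P ?V * w ?V - split_weight t ?V"
    by (simp add: right_diff_distrib sum_subtractf split_weight_def prob_set_def sum_distrib_right)
  finally show ?thesis using A by (simp add: gain_def diff_divide_distrib)
qed

section \<open>The optimal policy\<close>

text \<open>The policy is replayed on the hypotheses of \<open>V\<close> only: each test lowers the
  expected weight by at most \<open>\<gamma>\<close>, and at termination the weight is 0.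
  \<open>V\<close> is independent of \<open>S\<close> because it will be the version space of the
  greedy policy, while \<open>S\<close> is evidence of the policy being replayed. The number
  \<open>n\<close> bounds the remaining tests and drives the induction.\<close>

lemma policy_covers_weight:
  assumes V: "V \<subseteq> H" and \<gamma>: "\<And>t U. U \<subseteq> V \<Longrightarrow> U \<noteq> {} \<Longrightarrow> gain t U \<le> \<gamma>"
    and "finite S"
    and "\<And>h. h \<in> V \<inter> consistent H S \<Longrightarrow> runs pol h S (F h)"
    and "\<And>h. h \<in> V \<inter> consistent H S \<Longrightarrow> \<exists>r\<in>R. consistent H (F h) \<subseteq> r"
    and "\<And>h. h \<in> V \<inter> consistent H S \<Longrightarrow> card (F h) \<le> card S + n"
  shows "prob_set P (V \<inter> consistent H S) * w (V \<inter> consistent H S)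
       \<le> \<gamma> * (\<Sum>h\<in>V \<inter> consistent H S. P h * (real (card (F h)) - real (card S)))"
  using assms(3-)
proof (induction n arbitrary: S rule: less_induct)
  case (less n S)
  define U where "U = V \<inter> consistent H S"
  have U: "U \<subseteq> V" "U \<subseteq> H" using V by (auto simp: U_def)
  note runs_F = less.prems(2)[folded U_def]
  show ?case
  proof (cases "U = {}")
    case True
    then show ?thesis by (simp add: U_def[symmetric] prob_set_def)
  next
    case False
    then obtain h0 where h0: "h0 \<in> U" by blast
    show ?thesis
    proof (cases "pol S")
      case None
      have F: "F h = S" if "h \<in> U" for h
        using runs_F[OF that] None by (auto elim: runs.cases)
      obtain r where "r \<in> R" "consistent H S \<subseteq> r"
        using less.prems(3)[of h0] h0 F by (auto simp: U_def)
      then have "w U = 0" using U by (intro weight_in_region[of r]) (auto simp: U_def)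
      then show ?thesis using F by (simp add: U_def[symmetric])
    next
      case (Some t)
      have fresh: "(t, h t) \<notin> S" if "h \<in> U" for h
        using runs_fresh[OF runs_F[OF that] Some] .
      have step: "runs pol h (insert (t, h t) S) (F h)" if "h \<in> U" for h
        using runs_F[OF that] Some by (auto elim: runs.cases)
      \<comment> \<open>The test is new, so the run adds at least one pair, and the bound
        \<open>n\<close> cannot be 0.\<close>
      have "Suc (card S) \<le> card (F h0)"
        using card_mono[OF runs_finite[OF runs_F[OF h0] less.prems(1)] runs_subset[OF step[OF h0]]]
          fresh[OF h0] less.prems(1) by simp
      then obtain m where m: "n = Suc m"
        using less.prems(4)[of h0] h0 by (cases n) (auto simp: U_def)
      let ?O = "(\<lambda>h. h t) ` U"
      let ?c = "\<lambda>h. real (card (F h)) - real (card S)"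
      have branch: "prob_set P (sel U t v) * w (sel U t v)
          \<le> \<gamma> * (\<Sum>h\<in>sel U t v. P h * (?c h - 1))" if v: "v \<in> ?O" for v
      proof -
        let ?S = "insert (t, v) S"
        have eq: "V \<inter> consistent H ?S = sel U t v"
          by (auto simp: consistent_insert U_def sel_def)
        have card: "card ?S = Suc (card S)"
          using fresh v less.prems(1) by auto
        have "prob_set P (sel U t v) * w (sel U t v)
            \<le> \<gamma> * (\<Sum>h\<in>sel U t v. P h * (real (card (F h)) - real (card ?S)))"
        proof (rule less.IH[of m ?S, unfolded eq])
          fix h assume "h \<in> sel U t v"
          then have h: "h \<in> U" "h t = v" by (auto simp: sel_def)
          show "runs pol h ?S (F h)" using step[OF h(1)] h(2) by simp
          show "\<exists>r\<in>R. consistent H (F h) \<subseteq> r" using less.prems(3) h(1) by (simp add: U_def)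
          show "card (F h) \<le> card ?S + m" using less.prems(4)[of h] h(1) m card by (simp add: U_def)
        qed (use m less.prems(1) in auto)
        moreover have "real (card (F h)) - real (card ?S) = ?c h - 1" for h
          unfolding card by simp
        ultimately show ?thesis by simp
      qed
      \<comment> \<open>The immediate gain is charged to the current test; the \<open>- 1\<close> in
        the branch costs leaves exactly \<open>prob_set P U * \<gamma>\<close> for it.\<close>
      have "prob_set P U * w U = prob_set P U * gain t U + split_weight t U"
        using prob_times_gain[OF U(2) False] by simp
      also have "\<dots> \<le> prob_set P U * \<gamma> + (\<Sum>v\<in>?O. \<gamma> * (\<Sum>h\<in>sel U t v. P h * (?c h - 1)))"
        unfolding split_weight_eq[OF U(2)]
        using \<gamma>[OF U(1) False] prob_set_nonneg[OF U(2)] branch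
        by (intro add_mono mult_left_mono sum_mono) auto
      also have "\<dots> = prob_set P U * \<gamma> + \<gamma> * (\<Sum>h\<in>U. P h * (?c h - 1))"
        using sum_sel[OF U(2), of "\<lambda>h. P h * (?c h - 1)" t] by (simp add: sum_distrib_left)
      also have "(\<Sum>h\<in>U. P h * (?c h - 1)) = (\<Sum>h\<in>U. P h * ?c h) - prob_set P U"
        by (simp add: right_diff_distrib sum_subtractf prob_set_def)
      finally show ?thesis
        by (simp add: U_def[symmetric] algebra_simps)
    qed
  qed
qed

section \<open>The greedy policy\<close>

text \<open>A test that is constant on \<open>V\<close> has gain 0, so here every branch is a proper
  subset. Then \<open>weight_drop_ge\<close> applies under each hypothesis, and averaging preserves
  its bound.\<close>

lemma greedy_split:
  assumes V: "V \<subseteq> H" "V \<noteq> {}" and pos: "0 < gain t V"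
    and p: "0 < p" "\<forall>h\<in>H. p \<le> P h"
  shows "\<And>h. h \<in> V \<Longrightarrow> sel V t (h t) \<subset> V" and "p ^ k \<le> gain t V" and "0 < w V"
proof -
  show w: "0 < w V" using gain_le_weight[OF V(1), of t] pos by linarith
  show sub: "sel V t (h t) \<subset> V" if "h \<in> V" for h
  proof -
    have "sel V t (h t) \<noteq> V"
    proof
      assume "sel V t (h t) = V"
      then have "\<And>h'. h' \<in> V \<Longrightarrow> h' t = h t" by (auto simp: sel_def)
      then show False using gain_constant[OF V(1) _ V(2), of t "h t"] pos by simp
    qed
    then show ?thesis using sel_subset by blast
  qed
  have "prob_set P V * p ^ k = (\<Sum>h\<in>V. P h * p ^ k)"
    by (simp add: prob_set_def sum_distrib_right)
  also have "\<dots> \<le> (\<Sum>h\<in>V. P h * (w V - w (sel V t (h t))))"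
    using V P_pos weight_drop_ge[OF V(1) w sub p]
    by (intro sum_mono mult_left_mono) (auto simp: less_imp_le subset_iff)
  also have "\<dots> = prob_set P V * gain t V"
    unfolding prob_times_gain[OF V]
    by (simp add: right_diff_distrib sum_subtractf split_weight_def prob_set_def sum_distrib_right)
  finally show "p ^ k \<le> gain t V" using prob_set_pos[OF V] by simp
qed

text \<open>Minimizing the right-hand side over s > 0 gives the potential
  \<open>D (1 + ln (W / (p ^ k * D)))\<close>.  Keeping s free makes the bound linear in D and W, hence additive
  over the branches, and the restriction to s at least 1 makes it monotone in D.\<close>
lemma greedy_cost:
  fixes c :: "('t \<Rightarrow> 'b) \<Rightarrow> real"
  assumes greedy: "greedy_hec T H R P pol"
    and T: "\<And>t h. t \<notin> T \<Longrightarrow> h \<in> H \<Longrightarrow> h t = undefined"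
    and p: "0 < p" "\<forall>h\<in>H. p \<le> P h"
    and c: "\<And>h. h \<in> H \<Longrightarrow> 0 \<le> c h"
    and cover: "\<And>V \<gamma>. V \<subseteq> H \<Longrightarrow> (\<And>t U. U \<subseteq> V \<Longrightarrow> U \<noteq> {} \<Longrightarrow> gain t U \<le> \<gamma>) \<Longrightarrow>
                  prob_set P V * w V \<le> \<gamma> * (\<Sum>h\<in>V. P h * c h)"
    and "finite S"
  shows "\<exists>F. (\<forall>h\<in>consistent H S. runs pol h S (F h)) \<and>
    (\<forall>s\<ge>1. (\<Sum>h\<in>consistent H S. P h * (real (card (F h)) - real (card S)))
       \<le> (\<Sum>h\<in>consistent H S. P h * c h) * ln s
          + prob_set P (consistent H S) * w (consistent H S) / (p ^ k * s))"
  using \<open>finite S\<close>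
\<comment> \<open>Every greedy test has positive gain and thus shrinks the version space for each
  outcome; the induction also yields termination of the greedy policy.\<close>
proof (induction "card (consistent H S)" arbitrary: S rule: less_induct)
  case less
  define V where "V = consistent H S"
  define D where "D = (\<Sum>h\<in>V. P h * c h)"
  have V: "V \<subseteq> H" using consistent_subset by (simp add: V_def)
  have D: "0 \<le> D" unfolding D_def using V P_pos c
    by (intro sum_nonneg mult_nonneg_nonneg) (auto simp: less_imp_le subset_iff)
  show ?case
  proof (cases "V = {}")
    case True
    then show ?thesis by (simp add: V_def[symmetric] prob_set_def)
  next
    case nonempty: False
    show ?thesis
    proof (cases "\<exists>t\<in>T. hec_gain H R P t S > 0")
      case False
      then have "pol S = None" using greedy by (simp add: greedy_hec_def)
      then have "\<forall>h\<in>V. runs pol h S S" by (auto intro: runs.stop)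
      moreover have "0 \<le> D * ln s + prob_set P V * w V / (p ^ k * s)" if "s \<ge> 1" for s
        using that D p(1) prob_set_nonneg[OF V] weight_nonneg[OF V] by simp
      ultimately show ?thesis
        by (intro exI[of _ "\<lambda>_. S"]) (simp add: V_def[symmetric] D_def[symmetric])
    next
      case True
      have gains: "hec_gain H R P t' S = gain t' V" for t'
        using hec_gain_eq nonempty by (simp add: V_def)
      obtain t where t: "t \<in> T" "pol S = Some t" "\<And>t'. t' \<in> T \<Longrightarrow> gain t' V \<le> gain t V"
        using greedy True gains unfolding greedy_hec_def by metis
      have pos: "0 < gain t V" using True gains t(3) by (metis less_le_trans)
      have max: "gain t' U \<le> gain t V" if "U \<subseteq> V" "U \<noteq> {}" for t' U
      proof -
        have "gain t' U \<le> gain t' V" using gain_mono[OF that(1) V that(2)] .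
        also have "\<dots> \<le> gain t V"
        proof (cases "t' \<in> T")
          \<comment> \<open>The bound must cover any test a feasible policy might run. Outside
            \<open>T\<close> all hypotheses take the value \<open>undefined\<close>, so such a test
            has gain 0.\<close>
          case False
          then have "gain t' V = 0"
            using T V nonempty by (intro gain_constant) auto
          then show ?thesis using pos by simp
        qed (rule t(3))
        finally show ?thesis .
      qed
      note split = greedy_split[OF V nonempty pos p]
      let ?O = "(\<lambda>h. h t) ` V"
      have fresh: "(t, h t) \<notin> S" if "h \<in> V" for h
      proof
        assume "(t, h t) \<in> S"
        then have "sel V t (h t) = V" by (auto simp: V_def sel_def consistent_def)
        then show False using split(1)[OF that] by simp
      qed
      have finV: "finite V" using V finite_H finite_subset by blast
      \<comment> \<open>The induction hypothesis for outcome \<open>v\<close>, packaged so that one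
        \<open>F\<close> per outcome can be chosen before \<open>s\<close> is fixed.\<close>
      define good where "good v F \<longleftrightarrow> (\<forall>h\<in>sel V t v. runs pol h (insert (t, v) S) (F h)) \<and>
          (\<forall>s\<ge>1. (\<Sum>h\<in>sel V t v. P h * (real (card (F h)) - real (card (insert (t, v) S))))
             \<le> (\<Sum>h\<in>sel V t v. P h * c h) * ln s
                + prob_set P (sel V t v) * w (sel V t v) / (p ^ k * s))" for v F
      have "\<exists>F. good v F"
        if v: "v \<in> ?O" for v
      proof -
        obtain h where "h \<in> V" "v = h t" using v by blast
        then have "card (consistent H (insert (t, v) S)) < card V"
          using psubset_card_mono[OF finV split(1)] by (simp add: consistent_insert V_def)
        from less.hyps[OF this[unfolded V_def]] less.prems show ?thesis
          by (simp add: consistent_insert V_def good_def)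
      qed
      then obtain F where good: "\<And>v. v \<in> ?O \<Longrightarrow> good v (F v)"
        using bchoice[of ?O good] by blast
      have F: "runs pol h (insert (t, v) S) (F v h)" if "v \<in> ?O" "h \<in> sel V t v" for v h
        using good[OF that(1)] that(2) unfolding good_def by blast
      have cost: "(\<Sum>h\<in>sel V t v. P h * (real (card (F v h)) - real (card (insert (t, v) S))))
             \<le> (\<Sum>h\<in>sel V t v. P h * c h) * ln s
                + prob_set P (sel V t v) * w (sel V t v) / (p ^ k * s)" if "v \<in> ?O" "1 \<le> s" for v s
        using good[OF that(1)] that(2) unfolding good_def by blast
      define F' where "F' h = F (h t) h" for h
      have "runs pol h S (F' h)" if "h \<in> V" for h
        using F[of "h t" h] that t(2) by (auto simp: F'_def sel_def intro: runs.step)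
      moreover have "(\<Sum>h\<in>V. P h * (real (card (F' h)) - real (card S)))
          \<le> D * ln s + prob_set P V * w V / (p ^ k * s)" if s: "1 \<le> s" for s
      proof -
        define W where "W = prob_set P V * w V"
        define W' where "W' = split_weight t V"
        \<comment> \<open>The same parameter serves all branches, so their bounds add up to one in
          \<open>D\<close> and \<open>W'\<close>.\<close>
        define s' where "s' = max 1 (s * W' / W)"
        have A: "0 < prob_set P V" using prob_set_pos[OF V nonempty] .
        have drop: "prob_set P V * gain t V = W - W'"
          using prob_times_gain[OF V nonempty] by (simp add: W_def W'_def)
        have "(\<Sum>h\<in>V. P h * (real (card (F' h)) - real (card S)))
            = (\<Sum>v\<in>?O. \<Sum>h\<in>sel V t v. P h * (real (card (F' h)) - real (card S)))"
          by (rule sum_sel[OF V])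
        also have "\<dots> \<le> (\<Sum>v\<in>?O. prob_set P (sel V t v) + ((\<Sum>h\<in>sel V t v. P h * c h) * ln s'
                + prob_set P (sel V t v) * w (sel V t v) / (p ^ k * s')))"
        proof (rule sum_mono)
          fix v assume v: "v \<in> ?O"
          then have card: "card (insert (t, v) S) = Suc (card S)"
            using fresh less.prems by auto
          \<comment> \<open>The extra probability pays for the test \<open>t\<close> just
            made.\<close>
          have "(\<Sum>h\<in>sel V t v. P h * (real (card (F' h)) - real (card S)))
            = prob_set P (sel V t v)
              + (\<Sum>h\<in>sel V t v. P h * (real (card (F v h)) - real (card (insert (t, v) S))))"
            unfolding prob_set_def sum.distrib[symmetric]
            by (intro sum.cong) (auto simp: F'_def sel_def card algebra_simps)
          then show "(\<Sum>h\<in>sel V t v. P h * (real (card (F' h)) - real (card S)))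
            \<le> prob_set P (sel V t v) + ((\<Sum>h\<in>sel V t v. P h * c h) * ln s'
                + prob_set P (sel V t v) * w (sel V t v) / (p ^ k * s'))"
            using cost[OF v, of s'] by (simp add: s'_def)
        qed
        also have "\<dots> = prob_set P V + (D * ln s' + W' / (p ^ k * s'))"
          unfolding sum.distrib sum_distrib_right[symmetric] sum_divide_distrib[symmetric]
            D_def W'_def split_weight_eq[OF V]
          using sum_sel[OF V, of P t] sum_sel[OF V, of "\<lambda>h. P h * c h" t]
          by (simp add: prob_set_def)
        also have "\<dots> \<le> D * ln s + W / (p ^ k * s)"
          unfolding add.assoc[symmetric] s'_def
        proof (rule greedy_step_bound)
          show "prob_set P V * W \<le> D * (W - W')"
          proof -
            have "W \<le> gain t V * D" using cover[OF V max] by (simp add: W_def D_def)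
            then have "prob_set P V * W \<le> prob_set P V * (gain t V * D)"
              using A by (intro mult_left_mono) auto
            also have "\<dots> = D * (W - W')" using drop by (metis mult.assoc mult.commute)
            finally show ?thesis .
          qed
          show "p ^ k * prob_set P V \<le> W - W'"
            using split(2) A drop by (metis mult.commute mult_left_mono less_imp_le)
          show "0 < W" using split(3) A by (simp add: W_def)
          show "0 \<le> W'" using split_weight_nonneg[OF V] by (simp add: W'_def)
        qed (use D s p in auto)
        finally show ?thesis by (simp add: W_def)
      qed
      ultimately show ?thesis
        by (intro exI[of _ F']) (simp add: V_def[symmetric] D_def[symmetric])
    qed
  qed
qed

end

section \<open>Choice of the parameter and the approximation ratio\<close>

theorem theorem3:
  fixes T :: "'t set" and Outs :: "'b set" and H :: "('t \<Rightarrow> 'b) set"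
    and R :: "('t \<Rightarrow> 'b) set set" and P :: "('t \<Rightarrow> 'b) \<Rightarrow> real"
    and pol_hec pol_opt :: "('t, 'b) policy"
  assumes "finite T" and "finite Outs" and "finite H" and "H \<subseteq> T \<rightarrow>\<^sub>E Outs"
    and "\<forall>h\<in>H. P h \<in> \<rat>" and "\<forall>h\<in>H. P h > 0" and "(\<Sum>h\<in>H. P h) = 1"
    and "finite R" and "\<forall>r\<in>R. r \<subseteq> H" and "\<Union>R = H"
    and "greedy_hec T H R P pol_hec"
    and "feasible H R pol_opt"
    and "\<forall>pol. feasible H R pol \<longrightarrow> policy_cost H P pol_opt \<le> policy_cost H P pol"
  shows "policy_cost H P pol_hec
           \<le> (real (hec_k H R) * ln (1 / Min (P ` H)) + 1) * policy_cost H P pol_opt"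
proof -
  interpret hec_instance H R P
    using assms by unfold_locales auto
  define p where "p = Min (P ` H)"
  define c where "c h = real (card (policy_tests pol_opt h))" for h
  define C where "C = policy_cost H P pol_opt"
  define F where "F = final_evidence pol_opt"
  have "H \<noteq> {}" using assms(7) by auto
  have "p \<in> P ` H" unfolding p_def using \<open>H \<noteq> {}\<close> finite_H by (intro Min_in) auto
  then have p: "0 < p" "\<forall>h\<in>H. p \<le> P h"
    using P_pos finite_H by (auto simp: p_def)
  have prob_H: "prob_set P H = 1" using assms(7) by (simp add: prob_set_def)
  have "p \<le> 1"
  proof -
    obtain h where "h \<in> H" "p = P h" using \<open>p \<in> P ` H\<close> by blast
    then show ?thesis using prob_set_mono[of "{h}" H] prob_H by (simp add: prob_set_def)
  qed
  have C: "C = (\<Sum>h\<in>H. P h * c h)" by (simp add: C_def policy_cost_def c_def)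
  have consistent_empty: "consistent H {} = H" by (simp add: consistent_def)
  have F: "runs pol_opt h {} (F h)" "\<exists>r\<in>R. consistent H (F h) \<subseteq> r" if "h \<in> H" for h
    using assms(12) that final_evidence_eq unfolding feasible_def F_def by metis+
  have c_F: "c h = real (card (F h))" if "h \<in> H" for h
    using card_policy_tests[OF F(1)[OF that]] by (simp add: c_def)
  have cover: "prob_set P V * w V \<le> \<gamma> * (\<Sum>h\<in>V. P h * c h)"
    if V: "V \<subseteq> H" and \<gamma>: "\<And>t U. U \<subseteq> V \<Longrightarrow> U \<noteq> {} \<Longrightarrow> gain t U \<le> \<gamma>" for V \<gamma>
  proof -
    have eq: "V \<inter> consistent H {} = V" using V by (auto simp: consistent_empty)
    have "prob_set P V * w V \<le> \<gamma> * (\<Sum>h\<in>V. P h * (real (card (F h)) - real (card ({} :: ('t \<times> 'b) set))))"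
    \<comment> \<open>Any common bound on the lengths of the runs would do; the sum over
      \<open>H\<close> is one.\<close>
    proof (rule policy_covers_weight[OF V \<gamma>, of "{}" pol_opt F "\<Sum>h\<in>H. card (F h)", unfolded eq])
      fix h assume "h \<in> V"
      then have h: "h \<in> H" using V by blast
      show "runs pol_opt h {} (F h)" "\<exists>r\<in>R. consistent H (F h) \<subseteq> r" using F[OF h] .
      show "card (F h) \<le> card ({} :: ('t \<times> 'b) set) + (\<Sum>h\<in>H. card (F h))"
        using member_le_sum[OF h, of "\<lambda>h. card (F h)"] finite_H by simp
    qed auto
    also have "(\<Sum>h\<in>V. P h * (real (card (F h)) - real (card ({} :: ('t \<times> 'b) set)))) = (\<Sum>h\<in>V. P h * c h)"
      using V c_F by (intro sum.cong) auto
    finally show ?thesis .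
  qed
  \<comment> \<open>This absorbs the additive term left by \<open>greedy_cost\<close>. No gain
    exceeds \<open>w H\<close>, so a nonzero \<open>w H\<close> forces
    \<open>1 \<le> C\<close>.\<close>
  have w_le_C: "w H \<le> C"
  proof (cases "w H = 0")
    case True
    then show ?thesis unfolding C using P_pos by (auto intro!: sum_nonneg mult_nonneg_nonneg simp: c_def less_imp_le)
  next
    case False
    have "prob_set P H * w H \<le> w H * C"
      unfolding C by (intro cover order_trans[OF gain_le_weight weight_mono]) auto
    then have "1 \<le> C" using False weight_nonneg[of H] prob_H by simp
    then show ?thesis using weight_le_1[OF prob_H] by linarith
  qed
  obtain F' where F': "\<And>h. h \<in> H \<Longrightarrow> runs pol_hec h {} (F' h)"
    and cost: "\<And>s. 1 \<le> s \<Longrightarrow> (\<Sum>h\<in>H. P h * (real (card (F' h)) - real (card ({} :: ('t \<times> 'b) set))))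
      \<le> (\<Sum>h\<in>H. P h * c h) * ln s + prob_set P H * w H / (p ^ k * s)"
  proof -
    have "h t = undefined" if "t \<notin> T" "h \<in> H" for t h
      using assms(4) that by (auto simp: PiE_def extensional_def)
    then show ?thesis
      using greedy_cost[OF assms(11) _ p _ cover, of "{}"] that
      unfolding consistent_empty by (auto simp: c_def)
  qed
  \<comment> \<open>This choice cancels \<open>p ^ k\<close> in the denominator, leaving
    \<open>w H\<close>, and makes \<open>ln s\<close> the required logarithmic factor.\<close>
  define s where "s = (1 / p) ^ k"
  have s: "1 \<le> s" unfolding s_def using p(1) \<open>p \<le> 1\<close> by (intro one_le_power) simp
  have "p ^ k * s = 1" using p(1) by (simp add: s_def power_one_over)
  have "ln s = real k * ln (1 / p)" using p(1) by (simp add: s_def ln_realpow)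
  have "policy_cost H P pol_hec = (\<Sum>h\<in>H. P h * (real (card (F' h)) - real (card ({} :: ('t \<times> 'b) set))))"
    unfolding policy_cost_def using card_policy_tests[OF F'] by (intro sum.cong) auto
  also have "\<dots> \<le> C * ln s + prob_set P H * w H / (p ^ k * s)"
    using cost[OF s] by (simp add: C)
  also have "\<dots> = C * (real k * ln (1 / p)) + w H"
    using \<open>p ^ k * s = 1\<close> \<open>ln s = real k * ln (1 / p)\<close> prob_H by simp
  also have "\<dots> \<le> (real k * ln (1 / p) + 1) * C"
    using w_le_C by (simp add: algebra_simps)
  finally show ?thesis by (simp add: C_def p_def)
qed

end
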